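(* Let $n$ be a positive integer and put $\overline n=2\operatorname{lcm}(1,2,\dots,n)$. Let $M_{\overline n}$ be the least positive integer $M$ such that the set $\pi_{\overline n,M}$ is infinite, and put $\pi_{\overline n}=\pi_{\overline n,M_{\overline n}}$. Let $r\in\pi_{\overline n}$, and let $G_{n,r}$ be constructed as follows: $R_{n,r}$ is an extraspecial group of order $r^{2n+1}$ and exponent $r$; $A_{n,r}\leqslant\operatorname{Aut}(R_{n,r})$ is a subgroup isomorphic to $Sp_{2n}(r)$ centralizing $Z(R_{n,r})$; $X_{n,r}=R_{n,r}A_{n,r}$ is the natural semidirect product; $p$ is a prime with $p\equiv1\pmod r$; $V_{n,r}$ is a faithful irreducible $\mathbb{F}_pX_{n,r}$-module of dimension $r^n$; and $G_{n,r}=V_{n,r}X_{n,r}$ is the natural semidirect product. Then the $c$-dimension of $G_{n,r}$ does not exceed $2\left((n+1)^2+nM_{\overline n}\right)$.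
   Context: For a positive integer $m$, $\Omega(m)$ is the number of prime divisors of $m$ counted with multiplicity. For positive integers $n,M$, $\pi_{n,M}=\{r\mid r\text{ is an odd prime and }\Omega(r^n-1)\leqslant M\}$; it is known that for each $n$ some $\pi_{n,M}$ is infinite, so $M_{\overline n}$ is well defined. The $c$-dimension of a group $G$ is the maximal length $k$ of a chain of nested centralizers $C_G(Y_0)<C_G(Y_1)<\dots<C_G(Y_k)$ (strict inclusions) of subsets $Y_i\subseteq G$. *)

theory Defs
  imports "HOL-Algebra.Algebra" "HOL-Computational_Algebra.Computational_Algebra"
begin

definition bigOmega :: "nat \<Rightarrow> nat" where
  "bigOmega m = size (prime_factorization m)"

definition pi_set :: "nat \<Rightarrow> nat \<Rightarrow> nat set" where
  "pi_set n M = {r. Factorial_Ring.prime r \<and> odd r \<and> bigOmega (r ^ n - 1) \<le> M}"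

definition nbar :: "nat \<Rightarrow> nat" where
  "nbar n = 2 * Lcm {1..n}"

definition Mbar :: "nat \<Rightarrow> nat" where
  "Mbar m = (LEAST M. 0 < M \<and> infinite (pi_set m M))"

definition centralizer :: "('a, 'b) monoid_scheme \<Rightarrow> 'a set \<Rightarrow> 'a set" where
  "centralizer G Y = {g \<in> carrier G. \<forall>y\<in>Y. g \<otimes>\<^bsub>G\<^esub> y = y \<otimes>\<^bsub>G\<^esub> g}"

definition center :: "('a, 'b) monoid_scheme \<Rightarrow> 'a set" where
  "center G = centralizer G (carrier G)"

text \<open>Frattini subgroup: intersection of all maximal subgroups (the whole group if there are none).\<close>
definition maximal_subgroup :: "('a, 'b) monoid_scheme \<Rightarrow> 'a set \<Rightarrow> bool" where
  "maximal_subgroup G H \<longleftrightarrow> subgroup H G \<and> H \<noteq> carrier G \<and>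
     (\<forall>K. subgroup K G \<and> H \<subseteq> K \<longrightarrow> K = H \<or> K = carrier G)"

definition frattini :: "('a, 'b) monoid_scheme \<Rightarrow> 'a set" where
  "frattini G = carrier G \<inter> \<Inter> {H. maximal_subgroup G H}"

definition extraspecial :: "('a, 'b) monoid_scheme \<Rightarrow> nat \<Rightarrow> bool" where
  "extraspecial H r \<longleftrightarrow> group H \<and> Factorial_Ring.prime r \<and> finite (carrier H) \<and>
     (\<exists>k. card (carrier H) = r ^ k) \<and>
     center H = derived H (carrier H) \<and> frattini H = center H \<and> card (center H) = r"

definition centralizer_chain :: "('a, 'b) monoid_scheme \<Rightarrow> (nat \<Rightarrow> 'a set) \<Rightarrow> nat \<Rightarrow> bool" where
  "centralizer_chain G Y k \<longleftrightarrow> (\<forall>i\<le>k. Y i \<subseteq> carrier G) \<and>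
     (\<forall>i<k. centralizer G (Y i) \<subset> centralizer G (Y (Suc i)))"

definition c_dimension :: "('a, 'b) monoid_scheme \<Rightarrow> nat" where
  "c_dimension G = (GREATEST k. \<exists>Y. centralizer_chain G Y k)"

text \<open>Matrices are functions nat => nat => int, supported on {0..<2n} x {0..<2n},
  with entries in {0..<r} (representatives of F_r).\<close>
definition sympJ :: "nat \<Rightarrow> nat \<Rightarrow> nat \<Rightarrow> int" where
  "sympJ n i j = (if i < n \<and> j = i + n then 1
                  else if n \<le> i \<and> i < 2*n \<and> j + n = i then -1 else 0)"

definition sp_mult :: "nat \<Rightarrow> nat \<Rightarrow> (nat \<Rightarrow> nat \<Rightarrow> int) \<Rightarrow> (nat \<Rightarrow> nat \<Rightarrow> int) \<Rightarrow> (nat \<Rightarrow> nat \<Rightarrow> int)" where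
  "sp_mult n r A B = (\<lambda>i j. if i < 2*n \<and> j < 2*n then (\<Sum>k<2*n. A i k * B k j) mod int r else 0)"

definition sp_one :: "nat \<Rightarrow> nat \<Rightarrow> nat \<Rightarrow> int" where
  "sp_one n = (\<lambda>i j. if i < 2*n \<and> i = j then 1 else 0)"

definition sp_carrier :: "nat \<Rightarrow> nat \<Rightarrow> (nat \<Rightarrow> nat \<Rightarrow> int) set" where
  "sp_carrier n r = {A. (\<forall>i j. (2*n \<le> i \<or> 2*n \<le> j) \<longrightarrow> A i j = 0) \<and>
      (\<forall>i j. 0 \<le> A i j \<and> A i j < int r) \<and>
      (\<forall>i<2*n. \<forall>j<2*n. (\<Sum>k<2*n. \<Sum>l<2*n. A k i * sympJ n k l * A l j) mod int r = sympJ n i j mod int r)}"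

definition Sp :: "nat \<Rightarrow> nat \<Rightarrow> (nat \<Rightarrow> nat \<Rightarrow> int) monoid" where
  "Sp n r = \<lparr>carrier = sp_carrier n r, monoid.mult = sp_mult n r, monoid.one = sp_one n\<rparr>"

end

theory Submission
  imports Defs
begin

text \<open>
  Put \<open>C\<^sub>i\<close> for the centralizers of a chain, \<open>D\<^sub>i\<close> for the centralizer of \<open>C\<^sub>i\<close>, and \<open>V\<close> for the
  abelian normal subgroup. Since \<open>C\<^sub>i \<inter> V\<close> depends only on \<open>V D\<^sub>i\<close>, every strict step of the chain
  enlarges \<open>V C\<^sub>i\<close> or shrinks \<open>V D\<^sub>i\<close>. Hence \<open>\<Omega>|V C\<^sub>i| - \<Omega>|V D\<^sub>i|\<close> grows strictly, and as it
  varies between \<open>-\<Omega>|G/V|\<close> and \<open>\<Omega>|G/V|\<close>, the c-dimension is at most \<open>2 \<Omega>|G/V|\<close>.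

  Here \<open>G/V\<close> has order \<open>r^(2n+1) |Sp_2n(r)|\<close>, and counting symplectic bases one hyperbolic pair
  at a time gives \<open>|Sp_2n(r)| = \<Prod>(r^(2i) - 1) r^(2i-1)\<close>, the product over \<open>1 \<le> i \<le> n\<close>. Each
  \<open>r^(2i) - 1\<close> divides \<open>r^(nbar n) - 1\<close> because \<open>2i\<close> divides \<open>nbar n\<close>, so it has at most
  \<open>Mbar (nbar n)\<close> prime factors.
\<close>

subsection \<open>Prime factors counted with multiplicity\<close>

lemma bigOmega_mult:
  assumes "a \<noteq> 0" "b \<noteq> 0"
  shows "bigOmega (a * b) = bigOmega a + bigOmega b"
  using assms by (simp add: bigOmega_def prime_factorization_mult)

lemma bigOmega_prime_power:
  assumes "Factorial_Ring.prime r"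
  shows "bigOmega (r ^ k) = k"
  using assms by (simp add: bigOmega_def prime_factorization_prime_power)

lemma bigOmega_prod:
  assumes "finite S" "\<And>i. i \<in> S \<Longrightarrow> f i \<noteq> 0"
  shows "bigOmega (\<Prod>i\<in>S. f i) = (\<Sum>i\<in>S. bigOmega (f i))"
  using assms
proof (induction S rule: finite_induct)
  case empty
  then show ?case by (simp add: bigOmega_def)
next
  case (insert x F)
  then show ?case by (simp add: bigOmega_mult)
qed

lemma bigOmega_dvd_mono:
  assumes "a dvd b" "b \<noteq> 0"
  shows "bigOmega a \<le> bigOmega b"
proof -
  obtain c where "b = a * c" using assms(1) by (elim dvdE)
  with assms(2) show ?thesis by (simp add: bigOmega_mult)
qed

lemma bigOmega_dvd_strict_mono:
  assumes "a dvd b" "b \<noteq> 0" "a \<noteq> b"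
  shows "bigOmega a < bigOmega b"
proof -
  obtain c where c: "b = a * c" using assms(1) by (elim dvdE)
  then have "c \<noteq> 0" "c \<noteq> 1" using assms by auto
  then have "prime_factorization c \<noteq> {#}"
    by (simp add: prime_factorization_empty_iff)
  then have "0 < bigOmega c" by (simp add: bigOmega_def nonempty_has_size)
  with c assms(2) show ?thesis by (simp add: bigOmega_mult)
qed

subsection \<open>Chains of centralizers\<close>

lemma (in group) card_subgroup_dvd:
  assumes "subgroup H G" "subgroup K G" "H \<subseteq> K"
  shows "card H dvd card K"
proof -
  interpret K: group "G\<lparr>carrier := K\<rparr>"
    using assms(2) by (rule subgroup_imp_group)
  have "subgroup H (G\<lparr>carrier := K\<rparr>)"
    using assms by (intro subgroup_incl)
  from K.lagrange[OF this] show ?thesis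
    by (metis Coset.order_def dvd_triv_right partial_object.select_convs(1)
        partial_object.surjective partial_object.update_convs(1))
qed

lemma (in group) card_set_mult_trivial_inter:
  assumes H: "subgroup H G" and K: "subgroup K G" and int: "H \<inter> K = {\<one>}"
  shows "card (H <#> K) = card H * card K"
proof -
  have "inj_on (\<lambda>(h, k). h \<otimes> k) (H \<times> K)"
  proof (rule inj_onI, clarify)
    fix h k h' k'
    assume mem: "h \<in> H" "k \<in> K" "h' \<in> H" "k' \<in> K" and eq: "h \<otimes> k = h' \<otimes> k'"
    note cl = subgroup.mem_carrier[OF H mem(1)] subgroup.mem_carrier[OF K mem(2)]
      subgroup.mem_carrier[OF H mem(3)] subgroup.mem_carrier[OF K mem(4)]
    have *: "inv h' \<otimes> h = k' \<otimes> inv k"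
    proof -
      have "inv h' \<otimes> h = inv h' \<otimes> (h \<otimes> k) \<otimes> inv k"
        using cl by (simp add: m_assoc)
      also have "\<dots> = k' \<otimes> inv k"
        unfolding eq using cl by (simp add: m_assoc[symmetric])
      finally show ?thesis .
    qed
    have "inv h' \<otimes> h \<in> H"
      using mem H by (simp add: subgroup.m_closed subgroup.m_inv_closed)
    moreover have "k' \<otimes> inv k \<in> K"
      using mem K by (simp add: subgroup.m_closed subgroup.m_inv_closed)
    ultimately have "inv h' \<otimes> h = \<one>" "k' \<otimes> inv k = \<one>"
      using * int by auto
    then have "h = h'" using cl
      by (metis inv_equality inv_inv inv_closed)
    then show "h = h' \<and> k = k'"
      using eq cl by simp
  qed
  moreover have "H <#> K = (\<lambda>(h, k). h \<otimes> k) ` (H \<times> K)"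
    by (auto simp: set_mult_def)
  ultimately show ?thesis
    by (simp add: card_image card_cartesian_product)
qed

lemma (in group) subgroup_centralizer:
  assumes "Y \<subseteq> carrier G"
  shows "subgroup (centralizer G Y) G"
proof (rule subgroupI)
  fix a b assume a: "a \<in> centralizer G Y" and b: "b \<in> centralizer G Y"
  have "a \<otimes> b \<otimes> y = y \<otimes> (a \<otimes> b)" if "y \<in> Y" for y
  proof -
    have cl: "a \<in> carrier G" "b \<in> carrier G" "y \<in> carrier G"
      and ay: "a \<otimes> y = y \<otimes> a" and bY: "b \<otimes> y = y \<otimes> b"
      using a b that assms by (auto simp: centralizer_def)
    have "a \<otimes> b \<otimes> y = a \<otimes> y \<otimes> b" using cl bY by (simp add: m_assoc)
    also have "\<dots> = y \<otimes> (a \<otimes> b)" using cl ay by (simp add: m_assoc)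
    finally show ?thesis .
  qed
  with a b show "a \<otimes> b \<in> centralizer G Y" by (auto simp: centralizer_def)
next
  fix a assume a: "a \<in> centralizer G Y"
  have "inv a \<otimes> y = y \<otimes> inv a" if "y \<in> Y" for y
  proof -
    have cl: "a \<in> carrier G" "y \<in> carrier G" and ay: "a \<otimes> y = y \<otimes> a"
      using a that assms by (auto simp: centralizer_def)
    have "inv a \<otimes> y = inv a \<otimes> (y \<otimes> a) \<otimes> inv a" using cl by (simp add: m_assoc)
    also have "\<dots> = y \<otimes> inv a"
      unfolding ay[symmetric] using cl by (simp add: m_assoc[symmetric])
    finally show ?thesis .
  qed
  with a show "inv a \<in> centralizer G Y" by (auto simp: centralizer_def)
next
  show "centralizer G Y \<noteq> {}"
    using assms by (auto simp: centralizer_def intro!: exI[of _ \<one>])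
qed (auto simp: centralizer_def)

lemma centralizer_antimono: "Y \<subseteq> Z \<Longrightarrow> centralizer G Z \<subseteq> centralizer G Y"
  by (auto simp: centralizer_def)

lemma subset_double_centralizer:
  assumes "Y \<subseteq> carrier G"
  shows "Y \<subseteq> centralizer G (centralizer G Y)"
  using assms by (force simp: centralizer_def)

text \<open>Supplies the hypothesis \<open>cent\<close> of the next lemma for the members of a
  chain.\<close>

lemma triple_centralizer:
  assumes "Y \<subseteq> carrier G"
  shows "centralizer G (centralizer G (centralizer G Y)) = centralizer G Y"
proof
  show "centralizer G (centralizer G (centralizer G Y)) \<subseteq> centralizer G Y"
    by (rule centralizer_antimono[OF subset_double_centralizer[OF assms]])
  show "centralizer G Y \<subseteq> centralizer G (centralizer G (centralizer G Y))"
    by (rule subset_double_centralizer) (auto simp: centralizer_def)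
qed

text \<open>An element of \<open>V \<inter> C'\<close> commutes with the abelian \<open>V\<close>
  and with the centralizer of \<open>C'\<close>, hence with their product; by \<open>eqD\<close>
  this contains the centralizer of \<open>C\<close>, so the element lies in \<open>C\<close>. The
  modular law then turns \<open>C' \<subseteq> V <#> C\<close> into
  \<open>C' \<subseteq> C\<close>.\<close>

lemma (in group) centralizer_step_modulo_abelian_normal:
  assumes V: "subgroup V G" and ab: "\<forall>u\<in>V. \<forall>v\<in>V. u \<otimes> v = v \<otimes> u"
    and C: "subgroup C G" and C': "subgroup C' G" and CC': "C \<subseteq> C'"
    and cent: "centralizer G (centralizer G C) = C" "centralizer G (centralizer G C') = C'"
    and eqC: "V <#> C = V <#> C'"
    and eqD: "V <#> centralizer G C = V <#> centralizer G C'"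
  shows "C = C'"
proof
  have sub: "C \<subseteq> carrier G" "C' \<subseteq> carrier G" "V \<subseteq> carrier G"
    using C C' V by (auto dest: subgroup.subset)
  have VC: "V \<inter> C' \<subseteq> C"
  proof
    fix v assume v: "v \<in> V \<inter> C'"
    have "v \<otimes> d = d \<otimes> v" if d: "d \<in> centralizer G C" for d
    proof -
      have dc: "d \<in> carrier G" using d by (simp add: centralizer_def)
      have "\<one> \<otimes> d \<in> V <#> centralizer G C"
        using d subgroup.one_closed[OF V] unfolding set_mult_def by blast
      then have "d \<in> V <#> centralizer G C'"
        using dc by (simp only: eqD l_one)
      then obtain u e where ue: "u \<in> V" "e \<in> centralizer G C'" "d = u \<otimes> e"
        unfolding set_mult_def by blast
      have cl: "u \<in> carrier G" "e \<in> carrier G" "v \<in> carrier G"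
        using ue(1,2) v sub(3) by (auto simp: centralizer_def)
      have "v \<otimes> e = e \<otimes> v" using ue(2) v by (simp add: centralizer_def)
      moreover have "v \<otimes> u = u \<otimes> v" using ab ue v by blast
      ultimately show ?thesis
        using cl ue(3) by (metis m_assoc)
    qed
    then have "v \<in> centralizer G (centralizer G C)"
      using v sub(3) unfolding centralizer_def[of G "centralizer G C"] by blast
    then show "v \<in> C" unfolding cent(1) .
  qed
  show "C' \<subseteq> C"
  proof
    fix x assume x: "x \<in> C'"
    then have xc: "x \<in> carrier G" using sub by auto
    have "\<one> \<otimes> x \<in> V <#> C'"
      using x subgroup.one_closed[OF V] unfolding set_mult_def by blast
    then have "x \<in> V <#> C" using xc by (simp only: eqC l_one)
    then obtain v c where vc: "v \<in> V" "c \<in> C" "x = v \<otimes> c"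
      unfolding set_mult_def by blast
    have cl: "v \<in> carrier G" "c \<in> carrier G" using vc sub by auto
    then have "v = x \<otimes> inv c" using vc by (simp add: m_assoc)
    moreover have "x \<otimes> inv c \<in> C'"
      using x vc CC' C' by (auto intro: subgroup.m_closed subgroup.m_inv_closed)
    ultimately have "v \<in> C" using vc VC by auto
    then show "x \<in> C" using vc C by (auto intro: subgroup.m_closed)
  qed
qed (rule CC')

theorem (in group) c_dimension_le_abelian_normal:
  assumes V: "normal V G" and ab: "\<forall>u\<in>V. \<forall>v\<in>V. u \<otimes> v = v \<otimes> u"
    and fin: "finite (carrier G)" and card: "card (carrier G) = card V * m"
  shows "c_dimension G \<le> 2 * bigOmega m"
proof -
  have Vs: "subgroup V G" using V by (rule normal_imp_subgroup)
  \<comment> \<open>\<open>bigOmega 0\<close> is 0, so monotonicity along divisibility fails at 0;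
    orders must be known to be nonzero.\<close>
  have pos: "card H \<noteq> 0" if "subgroup H G" for H
    using that fin by (metis card_eq_0_iff empty_iff finite_subset subgroup.one_closed subgroup.subset)
  have bound: "k \<le> 2 * bigOmega m" if ch: "centralizer_chain G Y k" for Y k
  proof -
    define C where "C i = centralizer G (Y i)" for i
    define D where "D i = centralizer G (C i)" for i
    define f where "f H = int (bigOmega (card (V <#> H)))" for H
    have Y: "Y i \<subseteq> carrier G" if "i \<le> k" for i
      using ch that by (auto simp: centralizer_chain_def)
    have Cs: "subgroup (C i) G" if "i \<le> k" for i
      unfolding C_def by (rule subgroup_centralizer[OF Y[OF that]])
    have Ds: "subgroup (D i) G" if "i \<le> k" for i
      unfolding D_def using Cs[OF that] by (intro subgroup_centralizer) (rule subgroup.subset)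
    have VH: "subgroup (V <#> H) G" if "subgroup H G" for H
      using mult_norm_subgroup[OF V that] .
    have mono: "f H \<le> f K" if "subgroup H G" "subgroup K G" "H \<subseteq> K" for H K
    proof -
      have "V <#> H \<subseteq> V <#> K" using that by (auto simp: set_mult_def)
      then show ?thesis
        unfolding f_def using that
        by (auto intro!: bigOmega_dvd_mono card_subgroup_dvd VH pos)
    qed
    have strict: "f H < f K" if "subgroup H G" "subgroup K G" "H \<subseteq> K" "V <#> H \<noteq> V <#> K" for H K
    proof -
      have sub: "V <#> H \<subseteq> V <#> K" using that(3) by (auto simp: set_mult_def)
      have "finite (V <#> K)"
        using VH[OF that(2)] fin finite_subset subgroup.subset by blast
      then have "card (V <#> H) \<noteq> card (V <#> K)"
        using sub that(4) card_subset_eq by blast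
      then show ?thesis
        unfolding f_def using that sub
        by (auto intro!: bigOmega_dvd_strict_mono card_subgroup_dvd VH pos)
    qed
    have lower: "int (bigOmega (card V)) \<le> f H" if "subgroup H G" for H
    proof -
      have "V \<subseteq> V <#> H"
      proof
        fix v assume v: "v \<in> V"
        then have "v \<otimes> \<one> \<in> V <#> H"
          using subgroup.one_closed[OF that] unfolding set_mult_def by blast
        then show "v \<in> V <#> H" using v subgroup.mem_carrier[OF Vs] by simp
      qed
      then show ?thesis
        unfolding f_def using that
        by (auto intro!: bigOmega_dvd_mono card_subgroup_dvd VH pos Vs)
    qed
    have upper: "f H \<le> int (bigOmega (card V)) + int (bigOmega m)" if "subgroup H G" for H
    proof -
      have nz: "card V * m \<noteq> 0" using pos[OF subgroup_self] card by simp
      have "card (V <#> H) dvd card V * m"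
        unfolding card[symmetric]
        by (rule card_subgroup_dvd[OF VH[OF that] subgroup_self])
          (rule subgroup.subset[OF VH[OF that]])
      then have "bigOmega (card (V <#> H)) \<le> bigOmega (card V * m)"
        using nz by (rule bigOmega_dvd_mono)
      then show ?thesis using nz by (simp add: f_def bigOmega_mult)
    qed
    \<comment> \<open>As \<open>C\<close> grows, \<open>D\<close> shrinks, so neither term can lower
      the difference; a strict step changes one of the two products with \<open>V\<close>.\<close>
    have step: "f (C i) - f (D i) + 1 \<le> f (C (Suc i)) - f (D (Suc i))" if i: "i < k" for i
    proof -
      have lt: "C i \<subset> C (Suc i)"
        using ch i by (auto simp: centralizer_chain_def C_def)
      have le: "i \<le> k" "Suc i \<le> k" using i by auto
      have DD: "D (Suc i) \<subseteq> D i"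
        unfolding D_def using lt by (intro centralizer_antimono) auto
      have "V <#> C i \<noteq> V <#> C (Suc i) \<or> V <#> D (Suc i) \<noteq> V <#> D i"
        using centralizer_step_modulo_abelian_normal[OF Vs ab Cs[OF le(1)] Cs[OF le(2)]]
          lt triple_centralizer[OF Y[OF le(1)]] triple_centralizer[OF Y[OF le(2)]]
        unfolding D_def C_def by (metis psubset_eq)
      moreover have "f (C i) \<le> f (C (Suc i))" "f (D (Suc i)) \<le> f (D i)"
        using mono Cs Ds le lt DD by auto
      ultimately show ?thesis
        using strict[OF Cs[OF le(1)] Cs[OF le(2)]] strict[OF Ds[OF le(2)] Ds[OF le(1)] DD] lt
        by fastforce
    qed
    have "j \<le> k \<Longrightarrow> f (C 0) - f (D 0) + int j \<le> f (C j) - f (D j)" for j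
    proof (induction j)
      case (Suc j)
      then show ?case using step[of j] by simp
    qed simp
    \<comment> \<open>The contributions of \<open>V\<close> cancel: \<open>f (C k) - f (C 0)\<close>
      and \<open>f (D 0) - f (D k)\<close> are each at most \<open>bigOmega m\<close>.\<close>
    from this[of k] show ?thesis
      using lower[OF Cs[of 0]] upper[OF Cs[of k]] lower[OF Ds[of k]] upper[OF Ds[of 0]] by simp
  qed
  \<comment> \<open>\<open>GREATEST\<close> is attained only if some length occurs and lengths are
    bounded; this chain supplies length 0.\<close>
  have "centralizer_chain G (\<lambda>_. {}) 0" by (simp add: centralizer_chain_def)
  then have "\<exists>Y. centralizer_chain G Y (c_dimension G)"
    unfolding c_dimension_def using bound by (intro GreatestI_nat[where P = "\<lambda>k. \<exists>Y. centralizer_chain G Y k"]) blast+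
  then show ?thesis using bound by blast
qed

subsection \<open>The order of the symplectic group\<close>

text \<open>Canonical residues, and 0 beyond \<open>d\<close>, make equality of vectors over F_r
  equality of functions and match the columns of matrices in \<open>sp_carrier\<close>.\<close>

definition vecs :: "nat \<Rightarrow> nat \<Rightarrow> (nat \<Rightarrow> int) set" where
  "vecs d r = {v. (\<forall>i. 0 \<le> v i \<and> v i < int r) \<and> (\<forall>i\<ge>d. v i = 0)}"

text \<open>Covers sums (\<open>a = 1\<close>) and scalar multiples (\<open>u\<close> zero), so one
  closure condition captures linearity.\<close>

definition addmul :: "nat \<Rightarrow> (nat \<Rightarrow> int) \<Rightarrow> int \<Rightarrow> (nat \<Rightarrow> int) \<Rightarrow> (nat \<Rightarrow> int)" where
  "addmul r u a v = (\<lambda>i. (u i + a * v i) mod int r)"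

text \<open>The form with Gram matrix \<open>sympJ\<close>; values stay in the integers, so
  antisymmetry is exact.\<close>

definition sform :: "nat \<Rightarrow> (nat \<Rightarrow> int) \<Rightarrow> (nat \<Rightarrow> int) \<Rightarrow> int" where
  "sform n u v = (\<Sum>i<n. u i * v (n + i) - u (n + i) * v i)"

definition subspace_mod :: "nat \<Rightarrow> nat \<Rightarrow> (nat \<Rightarrow> int) set \<Rightarrow> bool" where
  "subspace_mod d r W \<longleftrightarrow> W \<subseteq> vecs d r \<and> (\<lambda>_. 0) \<in> W \<and>
     (\<forall>u\<in>W. \<forall>v\<in>W. \<forall>a. addmul r u a v \<in> W)"

definition functional_mod :: "nat \<Rightarrow> (nat \<Rightarrow> int) set \<Rightarrow> ((nat \<Rightarrow> int) \<Rightarrow> int) \<Rightarrow> bool" where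
  "functional_mod r W \<phi> \<longleftrightarrow> (\<forall>u\<in>W. \<forall>v\<in>W. \<forall>a. \<phi> (addmul r u a v) mod int r = (\<phi> u + a * \<phi> v) mod int r)"

text \<open>Extensional functions are \<open>undefined\<close> off the index set, vectors are 0
  there; the map changes this default.\<close>

lemma vecs_eq_PiE_image:
  "vecs d r = (\<lambda>g i. if i < d then g i else 0) ` (PiE {..<d} (\<lambda>_. {0..<int r}))" if "0 < r"
proof
  show "vecs d r \<subseteq> (\<lambda>g i. if i < d then g i else 0) ` (PiE {..<d} (\<lambda>_. {0..<int r}))"
  proof
    fix v assume v: "v \<in> vecs d r"
    then have "v = (\<lambda>i. if i < d then restrict v {..<d} i else 0)"
      by (auto simp: vecs_def fun_eq_iff)
    moreover have "restrict v {..<d} \<in> PiE {..<d} (\<lambda>_. {0..<int r})"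
      using v by (auto simp: vecs_def)
    ultimately show "v \<in> (\<lambda>g i. if i < d then g i else 0) ` (PiE {..<d} (\<lambda>_. {0..<int r}))"
      by blast
  qed
qed (use that in \<open>auto simp: vecs_def PiE_def Pi_def\<close>)

lemma card_vecs: "0 < r \<Longrightarrow> card (vecs d r) = r ^ d"
proof -
  assume r: "0 < r"
  have "inj_on (\<lambda>g i. if i < d then g i else 0) (PiE {..<d} (\<lambda>_. {0..<int r}))"
  proof (rule inj_onI)
    fix g h assume gh: "g \<in> PiE {..<d} (\<lambda>_. {0..<int r})" "h \<in> PiE {..<d} (\<lambda>_. {0..<int r})"
      and eq: "(\<lambda>i. if i < d then g i else 0) = (\<lambda>i. if i < d then h i else 0)"
    show "g = h"
    proof (rule PiE_ext[OF gh])
      fix i assume "i \<in> {..<d}"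
      then show "g i = h i" using fun_cong[OF eq, of i] by simp
    qed
  qed
  then show ?thesis
    by (simp add: vecs_eq_PiE_image[OF r] card_image card_PiE)
qed

lemma finite_vecs: "0 < r \<Longrightarrow> finite (vecs d r)"
  by (simp add: vecs_eq_PiE_image finite_PiE)

lemma subspace_mod_finite: "subspace_mod d r W \<Longrightarrow> 0 < r \<Longrightarrow> finite W"
  by (meson finite_subset finite_vecs subspace_mod_def)

lemma addmul_cancel:
  assumes "u \<in> vecs d r"
  shows "addmul r (addmul r u a v) (- a) v = u"
proof
  fix i
  have "addmul r (addmul r u a v) (- a) v i = (u i + a * v i - a * v i) mod int r"
    unfolding addmul_def by (simp add: mod_simps algebra_simps)
  also have "\<dots> = u i" using assms by (simp add: vecs_def)
  finally show "addmul r (addmul r u a v) (- a) v i = u i" .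
qed

text \<open>Translation by a multiple of \<open>w\<close> maps any fibre of \<open>\<phi>\<close>
  injectively into any other, so the \<open>r\<close> fibres partitioning \<open>W\<close> have
  equal size.\<close>

lemma functional_mod_fiber_card:
  assumes r: "Factorial_Ring.prime r" and W: "subspace_mod d r W" and \<phi>: "functional_mod r W \<phi>"
    and w: "w \<in> W" "\<phi> w mod int r \<noteq> 0" and c: "0 \<le> c" "c < int r"
  shows "card W = r * card {u \<in> W. \<phi> u mod int r = c}"
proof -
  have r0: "0 < r" using r prime_gt_0_nat by blast
  have fin: "finite W" using subspace_mod_finite[OF W r0] .
  have "coprime (\<phi> w) (int r)"
    using w r by (simp add: coprime_commute prime_imp_coprime mod_eq_0_iff_dvd)
  then obtain b where b: "(\<phi> w * b) mod int r = 1 mod int r"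
  proof -
    obtain u v where "u * \<phi> w + v * int r = 1"
      using \<open>coprime (\<phi> w) (int r)\<close> bezout_int[of "\<phi> w" "int r"] by auto
    then have "1 - \<phi> w * u = v * int r" by (simp add: algebra_simps)
    then have "(\<phi> w * u) mod int r = 1 mod int r"
      by (metis dvd_triv_right mod_eq_dvd_iff)
    then show ?thesis by (rule that)
  qed
  define F where "F c = {u \<in> W. \<phi> u mod int r = c}" for c
  have inj: "card (F c) \<le> card (F c')" if c': "0 \<le> c'" "c' < int r" for c c'
  proof (rule card_inj_on_le)
    \<comment> \<open>As \<open>b\<close> inverts \<open>\<phi> w\<close> modulo \<open>r\<close>,
      this shift moves the value from \<open>c\<close> to \<open>c'\<close>.\<close>
    let ?a = "(c' - c) * b"
    let ?t = "\<lambda>u. addmul r u ?a w"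
    show "inj_on ?t (F c)"
      by (rule inj_on_inverseI[where g = "\<lambda>u. addmul r u (- ?a) w"])
        (use W in \<open>auto simp: F_def subspace_mod_def intro!: addmul_cancel\<close>)
    show "?t ` F c \<subseteq> F c'"
    proof clarify
      fix u assume u: "u \<in> F c"
      have "?t u \<in> W" using u W w by (auto simp: F_def subspace_mod_def)
      moreover have "\<phi> (?t u) mod int r = c'"
      proof -
        have "\<phi> (?t u) mod int r = (\<phi> u + ?a * \<phi> w) mod int r"
          using \<phi> u w by (auto simp: F_def functional_mod_def)
        also have "\<dots> = (\<phi> u mod int r + (c' - c) * ((\<phi> w * b) mod int r)) mod int r"
        proof -
          have "\<phi> u + ?a * \<phi> w = \<phi> u + (c' - c) * (\<phi> w * b)" by (simp add: algebra_simps)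
          then show ?thesis by (simp only:) (intro mod_add_cong mod_mult_cong; simp)
        qed
        also have "\<dots> = (c + (c' - c) * (1 mod int r)) mod int r"
          using u unfolding b F_def by simp
        also have "\<dots> = (c + (c' - c) * 1) mod int r"
          by (intro mod_add_cong mod_mult_cong; simp)
        also have "\<dots> = c'" using c' by simp
        finally show ?thesis .
      qed
      ultimately show "?t u \<in> F c'" by (simp add: F_def)
    qed
    show "finite (F c')" using fin by (simp add: F_def)
  qed
  have "W = (\<Union>x\<in>{0..<int r}. F x)"
    using r0 by (auto simp: F_def)
  then have "card W = card (\<Union>x\<in>{0..<int r}. F x)" by simp
  also have "\<dots> = (\<Sum>x\<in>{0..<int r}. card (F x))"
    by (rule card_UN_disjoint) (use fin in \<open>auto simp: F_def\<close>)
  also have "\<dots> = (\<Sum>x\<in>{0..<int r}. card (F c))"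
    by (rule sum.cong) (use inj c in \<open>auto intro!: antisym\<close>)
  also have "\<dots> = r * card (F c)" by simp
  finally show ?thesis by (simp add: F_def)
qed

lemma functional_mod_kernel_subspace:
  assumes W: "subspace_mod d r W" and \<phi>: "functional_mod r W \<phi>"
  shows "subspace_mod d r {u \<in> W. \<phi> u mod int r = 0}"
proof -
  have "\<phi> (addmul r u a v) mod int r = 0"
    if "u \<in> W" "v \<in> W" "\<phi> u mod int r = 0" "\<phi> v mod int r = 0" for u v a
  proof -
    have "\<phi> (addmul r u a v) mod int r = (\<phi> u + a * \<phi> v) mod int r"
      using \<phi> that by (auto simp: functional_mod_def)
    also have "\<dots> = (\<phi> u mod int r + a * (\<phi> v mod int r)) mod int r"
      by (intro mod_add_cong mod_mult_cong) auto
    also have "\<dots> = 0" using that by simp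
    finally show ?thesis .
  qed
  note * = this
  have z: "(\<lambda>_. 0) \<in> W" using W by (auto simp: subspace_mod_def)
  \<comment> \<open>Writing the zero vector as its difference with itself forces its value to vanish
    modulo \<open>r\<close>.\<close>
  have "addmul r (\<lambda>_. 0) (- 1) (\<lambda>_. 0) = (\<lambda>_. 0)" by (simp add: addmul_def)
  then have "\<phi> (\<lambda>_. 0) mod int r = (\<phi> (\<lambda>_. 0) + (- 1) * \<phi> (\<lambda>_. 0)) mod int r"
    using \<phi> z unfolding functional_mod_def by metis
  then have "\<phi> (\<lambda>_. 0) mod int r = 0" by simp
  with * W z show ?thesis by (auto simp: subspace_mod_def)
qed

section \<open>The symplectic form and hyperbolic pairs\<close>

lemma sform_swap: "sform n v u = - sform n u v"
  by (simp add: sform_def sum_negf[symmetric] algebra_simps)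

lemma sform_self [simp]: "sform n v v = 0"
  by (simp add: sform_def algebra_simps)

lemma sform_addmul_right: "sform n u (addmul r v a w) mod int r = (sform n u v + a * sform n u w) mod int r"
proof -
  have "sform n u (addmul r v a w) mod int r =
    (\<Sum>i<n. (u i * addmul r v a w (n + i) - u (n + i) * addmul r v a w i) mod int r) mod int r"
    unfolding sform_def by (simp add: mod_sum_eq)
  also have "\<dots> = (\<Sum>i<n. (u i * (v (n + i) + a * w (n + i)) - u (n + i) * (v i + a * w i)) mod int r) mod int r"
    unfolding addmul_def
    by (rule arg_cong[where f = "\<lambda>x. x mod int r"], rule sum.cong, simp,
        intro mod_diff_cong mod_mult_cong) simp_all
  also have "\<dots> = (\<Sum>i<n. u i * (v (n + i) + a * w (n + i)) - u (n + i) * (v i + a * w i)) mod int r"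
    by (rule mod_sum_eq)
  also have "(\<Sum>i<n. u i * (v (n + i) + a * w (n + i)) - u (n + i) * (v i + a * w i)) = sform n u v + a * sform n u w"
    unfolding sform_def by (simp add: sum.distrib[symmetric] sum_distrib_left algebra_simps)
  finally show ?thesis .
qed

lemma functional_mod_sform: "functional_mod r W (sform n u)"
  by (simp add: functional_mod_def sform_addmul_right)

definition nondeg :: "nat \<Rightarrow> nat \<Rightarrow> (nat \<Rightarrow> int) set \<Rightarrow> bool" where
  "nondeg n r W \<longleftrightarrow> (\<forall>u\<in>W. (\<forall>w\<in>W. sform n u w mod int r = 0) \<longrightarrow> u = (\<lambda>_. 0))"

text \<open>The orthogonal complement in \<open>W\<close> of the plane spanned by \<open>e\<close>
  and \<open>f\<close>.\<close>

definition hperp :: "nat \<Rightarrow> nat \<Rightarrow> (nat \<Rightarrow> int) set \<Rightarrow> (nat \<Rightarrow> int) \<Rightarrow> (nat \<Rightarrow> int) \<Rightarrow> (nat \<Rightarrow> int) set" where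
  "hperp n r W e f = {u \<in> W. sform n e u mod int r = 0 \<and> sform n f u mod int r = 0}"

text \<open>The functional of \<open>e\<close> is nonzero at \<open>f\<close>; on its kernel, which
  contains \<open>e\<close>, the functional of \<open>f\<close> is nonzero at \<open>e\<close>. Each
  cuts the size by \<open>r\<close>. Nondegeneracy passes down because every vector of
  \<open>W\<close> differs from one in the complement by a combination of \<open>e\<close> and
  \<open>f\<close>.\<close>

lemma hperp_symplectic:
  assumes r: "Factorial_Ring.prime r" and W: "subspace_mod d r W" and nd: "nondeg n r W"
    and ef: "e \<in> W" "f \<in> W" "sform n e f mod int r = 1"
  shows "subspace_mod d r (hperp n r W e f)" "nondeg n r (hperp n r W e f)"
    "card W = r\<^sup>2 * card (hperp n r W e f)"
proof -
  have r1: "1 < int r" using r prime_gt_1_nat by auto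
  define W1 where "W1 = {u \<in> W. sform n e u mod int r = 0}"
  have W1: "subspace_mod d r W1"
    unfolding W1_def by (rule functional_mod_kernel_subspace[OF W functional_mod_sform])
  have H: "hperp n r W e f = {u \<in> W1. sform n f u mod int r = 0}"
    by (auto simp: hperp_def W1_def)
  show "subspace_mod d r (hperp n r W e f)"
    unfolding H by (rule functional_mod_kernel_subspace[OF W1 functional_mod_sform])
  have "card W = r * card W1"
    unfolding W1_def
    by (rule functional_mod_fiber_card[OF r W functional_mod_sform, of f]) (use ef r1 in auto)
  moreover have "sform n f e mod int r \<noteq> 0"
    using ef r1 unfolding sform_swap[of n f e]
    by (metis add.inverse_inverse dvd_minus_iff mod_0_imp_dvd mod_eq_0_iff_dvd zero_neq_one)
  then have "card W1 = r * card (hperp n r W e f)"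
    unfolding H
    by (intro functional_mod_fiber_card[OF r W1 functional_mod_sform, of e]) (use ef r1 in \<open>auto simp: W1_def\<close>)
  ultimately show "card W = r\<^sup>2 * card (hperp n r W e f)"
    by (simp add: power2_eq_square)
  show "nondeg n r (hperp n r W e f)"
    unfolding nondeg_def
  proof (intro ballI impI)
    fix u assume u: "u \<in> hperp n r W e f" and perp: "\<forall>w\<in>hperp n r W e f. sform n u w mod int r = 0"
    have ue: "sform n u e mod int r = 0" and uf: "sform n u f mod int r = 0"
      using u unfolding hperp_def sform_swap[of n u] by (auto simp: mod_eq_0_iff_dvd)
    have "sform n u w mod int r = 0" if w: "w \<in> W" for w
    proof -
      \<comment> \<open>These coefficients project \<open>w\<close> onto the complement:
        \<open>sform n e f\<close> is congruent to 1 and \<open>sform n f e\<close> to -1, so the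
        products of \<open>w'\<close> with \<open>e\<close> and \<open>f\<close> cancel.\<close>
      define a where "a = sform n f w"
      define b where "b = - sform n e w"
      define w' where "w' = addmul r (addmul r w a e) b f"
      have w1: "addmul r w a e \<in> W" using W ef w by (auto simp: subspace_mod_def)
      then have w': "w' \<in> W" using W ef by (auto simp: subspace_mod_def w'_def)
      have red: "sform n x w' mod int r = (sform n x w + a * sform n x e + b * sform n x f) mod int r" for x
      proof -
        have "sform n x w' mod int r = (sform n x (addmul r w a e) + b * sform n x f) mod int r"
          unfolding w'_def by (rule sform_addmul_right)
        also have "\<dots> = (sform n x w + a * sform n x e + b * sform n x f) mod int r"
          by (intro mod_add_cong sform_addmul_right refl)
        finally show ?thesis .
      qed
      have "sform n e w' mod int r = (sform n e w + b * (sform n e f mod int r)) mod int r"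
        unfolding red by (intro mod_add_cong mod_mult_cong) simp_all
      then have 1: "sform n e w' mod int r = 0" using ef by (simp add: b_def)
      have "sform n f w' mod int r = (sform n f w - a * (sform n e f mod int r)) mod int r"
      proof -
        have "sform n f w + a * sform n f e + b * sform n f f = sform n f w - a * sform n e f"
          by (simp add: sform_swap[of n f e])
        then show ?thesis
          unfolding red by (simp only:) (intro mod_diff_cong mod_mult_cong; simp)
      qed
      then have 2: "sform n f w' mod int r = 0" using ef by (simp add: a_def)
      have "w' \<in> hperp n r W e f" using w' 1 2 by (simp add: hperp_def)
      then have "0 = sform n u w' mod int r" using perp by simp
      also have "\<dots> = (sform n u w + a * (sform n u e mod int r) + b * (sform n u f mod int r)) mod int r"
        unfolding red by (intro mod_add_cong mod_mult_cong) simp_all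
      also have "\<dots> = sform n u w mod int r" using ue uf by simp
      finally show ?thesis by simp
    qed
    moreover have "u \<in> W" using u by (simp add: hperp_def)
    ultimately show "u = (\<lambda>_. 0)" using nd by (auto simp: nondeg_def)
  qed
qed

text \<open>Lists of \<open>k\<close> mutually orthogonal hyperbolic pairs; the recursion into
  \<open>hperp\<close> allows counting by induction, and \<open>hpairs_iff\<close> gives the direct
  description.\<close>

fun hpairs :: "nat \<Rightarrow> nat \<Rightarrow> nat \<Rightarrow> (nat \<Rightarrow> int) set \<Rightarrow> ((nat \<Rightarrow> int) \<times> (nat \<Rightarrow> int)) list set" where
  "hpairs n r 0 W = {[]}"
| "hpairs n r (Suc k) W =
     (\<Union>e\<in>W. \<Union>f\<in>{f\<in>W. sform n e f mod int r = 1}. (#) (e, f) ` hpairs n r k (hperp n r W e f))"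

lemma finite_hpairs: "finite W \<Longrightarrow> finite (hpairs n r k W)"
  by (induction k arbitrary: W) (auto simp: hperp_def)

text \<open>The partners \<open>f\<close> of a nonzero \<open>e\<close> form an affine hyperplane,
  and the number of continuations is the same for every pair, since the complement is again
  nondegenerate, of size smaller by the factor \<open>r\<^sup>2\<close>.\<close>

lemma card_hpairs:
  assumes r: "Factorial_Ring.prime r"
  shows "subspace_mod d r W \<Longrightarrow> nondeg n r W \<Longrightarrow> card W = r ^ (2 * k) \<Longrightarrow>
    card (hpairs n r k W) = (\<Prod>i=1..k. (r ^ (2 * i) - 1) * r ^ (2 * i - 1))"
proof (induction k arbitrary: W)
  case (Suc k)
  have r1: "1 < int r" using r prime_gt_1_nat by auto
  have r0: "0 < r" using r1 by simp
  have fin: "finite W" using subspace_mod_finite[OF Suc.prems(1) r0] .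
  have z: "(\<lambda>_. 0) \<in> W" using Suc.prems(1) by (auto simp: subspace_mod_def)
  let ?P = "\<Prod>i=1..k. (r ^ (2 * i) - 1) * r ^ (2 * i - 1)"
  let ?F = "\<lambda>e. {f\<in>W. sform n e f mod int r = 1}"
  let ?S = "\<lambda>e f. (#) (e, f) ` hpairs n r k (hperp n r W e f)"
  have inner: "card (\<Union>f\<in>?F e. ?S e f) = card (?F e) * ?P" if e: "e \<in> W" for e
  proof -
    have "card (\<Union>f\<in>?F e. ?S e f) = (\<Sum>f\<in>?F e. card (?S e f))"
      by (rule card_UN_disjoint) (use fin in \<open>auto intro!: finite_hpairs simp: hperp_def\<close>)
    also have "\<dots> = (\<Sum>f\<in>?F e. ?P)"
    proof (rule sum.cong[OF refl])
      fix f assume f: "f \<in> ?F e"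
      then have f: "f \<in> W" "sform n e f mod int r = 1" by auto
      note h = hperp_symplectic[OF r Suc.prems(1,2) e f]
      have "r\<^sup>2 * card (hperp n r W e f) = r\<^sup>2 * r ^ (2 * k)"
        using h(3) Suc.prems(3) by (metis mult_Suc_right power_add)
      then have "card (hperp n r W e f) = r ^ (2 * k)" using r0 by (subst (asm) mult_cancel1) simp
      from Suc.IH[OF h(1,2) this] show "card (?S e f) = ?P"
        by (simp add: card_image)
    qed
    finally show ?thesis by simp
  qed
  have cF: "card (?F e) = r ^ (2 * Suc k - 1)" if e: "e \<in> W" "e \<noteq> (\<lambda>_. 0)" for e
  proof -
    obtain w where w: "w \<in> W" "sform n e w mod int r \<noteq> 0"
      using Suc.prems(2) e by (auto simp: nondeg_def)
    have "card W = r * card (?F e)"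
      by (rule functional_mod_fiber_card[OF r Suc.prems(1) functional_mod_sform w]) (use r1 in auto)
    then show ?thesis using Suc.prems(3) r0 by simp
  qed
  \<comment> \<open>The zero vector has no partner, whence the factor
    \<open>r ^ (2 * i) - 1\<close>.\<close>
  have c0: "?F (\<lambda>_. 0) = {}" by (simp add: sform_def)
  have "card (hpairs n r (Suc k) W) = (\<Sum>e\<in>W. card (\<Union>f\<in>?F e. ?S e f))"
    unfolding hpairs.simps
    by (rule card_UN_disjoint) (use fin in \<open>auto intro!: finite_hpairs simp: hperp_def\<close>)
  also have "\<dots> = (\<Sum>e\<in>W. card (?F e) * ?P)"
    by (rule sum.cong) (use inner in auto)
  also have "\<dots> = (\<Sum>e\<in>W - {\<lambda>_. 0}. card (?F e) * ?P)"
    by (rule sum.mono_neutral_right) (use fin c0 in auto)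
  also have "\<dots> = (\<Sum>e\<in>W - {\<lambda>_. 0}. r ^ (2 * Suc k - 1) * ?P)"
    by (rule sum.cong) (use cF in auto)
  also have "\<dots> = (r ^ (2 * Suc k) - 1) * (r ^ (2 * Suc k - 1) * ?P)"
    using Suc.prems(3) z fin by simp
  also have "\<dots> = (\<Prod>i=1..Suc k. (r ^ (2 * i) - 1) * r ^ (2 * i - 1))"
    by simp
  finally show ?case .
qed simp

section \<open>Symplectic matrices as symplectic bases\<close>

definition sbasis :: "nat \<Rightarrow> nat \<Rightarrow> nat \<Rightarrow> (nat \<Rightarrow> nat \<Rightarrow> int) \<Rightarrow> (nat \<Rightarrow> nat \<Rightarrow> int) \<Rightarrow> bool" where
  "sbasis n r k e f \<longleftrightarrow> (\<forall>i<k. \<forall>j<k. sform n (e i) (e j) mod int r = 0 \<and>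
     sform n (f i) (f j) mod int r = 0 \<and> sform n (e i) (f j) mod int r = (if i = j then 1 else 0))"

lemma sform_mod_eq_0_swap: "sform n u v mod int r = 0 \<longleftrightarrow> sform n v u mod int r = 0"
  unfolding sform_swap[of n u v] by (simp add: mod_eq_0_iff_dvd)

lemma sbasis_Suc:
  "sbasis n r (Suc k) e f \<longleftrightarrow> sform n (e 0) (f 0) mod int r = 1 \<and>
     (\<forall>i<k. \<forall>v\<in>{e (Suc i), f (Suc i)}. sform n (e 0) v mod int r = 0 \<and> sform n (f 0) v mod int r = 0) \<and>
     sbasis n r k (\<lambda>i. e (Suc i)) (\<lambda>i. f (Suc i))"
  unfolding sbasis_def All_less_Suc2
  by (auto simp: sform_mod_eq_0_swap[of n "f 0"] sform_mod_eq_0_swap[of n _ "e 0"])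

text \<open>\<open>W\<close> varies in the induction: the tail lives in
  \<open>hperp n r W e f\<close>, where membership encodes orthogonality to the first pair, as split
  off by \<open>sbasis_Suc\<close>.\<close>

lemma hpairs_iff:
  "ps \<in> hpairs n r k W \<longleftrightarrow> length ps = k \<and> (\<forall>i<k. fst (ps ! i) \<in> W \<and> snd (ps ! i) \<in> W) \<and>
     sbasis n r k (\<lambda>i. fst (ps ! i)) (\<lambda>i. snd (ps ! i))"
proof (induction k arbitrary: ps W)
  case 0
  then show ?case by (auto simp: sbasis_def)
next
  case (Suc k)
  show ?case
  proof (cases ps)
    case Nil
    then show ?thesis by auto
  next
    case (Cons p qs)
    obtain e f where p: "p = (e, f)" by fastforce
    have "ps \<in> hpairs n r (Suc k) W \<longleftrightarrow>
      e \<in> W \<and> f \<in> W \<and> sform n e f mod int r = 1 \<and> qs \<in> hpairs n r k (hperp n r W e f)"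
      by (auto simp: Cons p)
    then show ?thesis
      unfolding Suc.IH sbasis_Suc All_less_Suc2 by (auto simp: Cons p hperp_def)
  qed
qed

lemma sum_lessThan_double: "(\<Sum>i<2*n. g i) = (\<Sum>i<n. g i + g (n + i))" for g :: "nat \<Rightarrow> int"
proof -
  have "{..<2*n} = {..<n} \<union> (\<lambda>i. n + i) ` {..<n}"
  proof -
    have "x \<in> (\<lambda>i. n + i) ` {..<n}" if "x < 2 * n" "\<not> x < n" for x
      using that by (intro image_eqI[of _ _ "x - n"]) auto
    then show ?thesis by auto
  qed
  then have "(\<Sum>i<2*n. g i) = (\<Sum>i<n. g i) + (\<Sum>i\<in>(\<lambda>i. n + i) ` {..<n}. g i)"
    by (simp only:) (rule sum.union_disjoint, auto)
  also have "(\<Sum>i\<in>(\<lambda>i. n + i) ` {..<n}. g i) = (\<Sum>i<n. g (n + i))"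
    by (subst sum.reindex) auto
  finally show ?thesis by (simp add: sum.distrib)
qed

text \<open>Each row of \<open>sympJ\<close> in range has a single nonzero entry, so the inner sum
  collapses.\<close>

lemma sympJ_sum_eq_sform:
  "(\<Sum>k<2*n. \<Sum>l<2*n. u k * sympJ n k l * v l) = sform n u v"
proof -
  have 1: "(\<Sum>l<2*n. u k * sympJ n k l * v l) = u k * v (n + k)" if "k < n" for k
  proof -
    have "(\<Sum>l<2*n. u k * sympJ n k l * v l) = (\<Sum>l<2*n. if l = n + k then u k * v l else 0)"
      using that by (intro sum.cong) (auto simp: sympJ_def)
    then show ?thesis using that by simp
  qed
  have 2: "(\<Sum>l<2*n. u (n + k) * sympJ n (n + k) l * v l) = - (u (n + k) * v k)" if "k < n" for k
  proof -
    have "(\<Sum>l<2*n. u (n + k) * sympJ n (n + k) l * v l) = (\<Sum>l<2*n. if l = k then - (u (n + k) * v l) else 0)"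
      using that by (intro sum.cong) (auto simp: sympJ_def)
    then show ?thesis using that by simp
  qed
  show ?thesis
    unfolding sum_lessThan_double[of "\<lambda>k. \<Sum>l<2*n. u k * sympJ n k l * v l"] sform_def
    by (intro sum.cong) (auto simp: 1 2)
qed

lemma all_less_double: "(\<forall>i<2*n. P i) \<longleftrightarrow> (\<forall>i<n. P i \<and> P (n + i))" for n :: nat
proof safe
  fix i assume *: "\<forall>i<n. P i \<and> P (n + i)" "i < 2 * n"
  show "P i"
  proof (cases "i < n")
    case False
    then have "P (n + (i - n))" using * by (intro *(1)[rule_format, THEN conjunct2]) auto
    then show ?thesis using False by simp
  qed (use * in auto)
qed auto

text \<open>The defining equation prescribes \<open>sform\<close> on all pairs of columns: columns
  \<open>j\<close> and \<open>n + j\<close> are the pairs of a symplectic basis.\<close>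

lemma sp_carrier_iff:
  assumes r: "1 < r"
  shows "A \<in> sp_carrier n r \<longleftrightarrow>
    (\<forall>j<2*n. (\<lambda>i. A i j) \<in> vecs (2*n) r) \<and> (\<forall>i j. 2*n \<le> j \<longrightarrow> A i j = 0) \<and>
    sbasis n r n (\<lambda>j i. A i j) (\<lambda>j i. A i (n + j))"
proof -
  have m1: "(- x) mod int r = (- 1) mod int r \<longleftrightarrow> x mod int r = 1" for x
    using r by (metis add.inverse_inverse mod_minus_cong mod_pos_pos_trivial of_nat_1 of_nat_less_iff zero_le_one)
  have "(\<forall>i<2*n. \<forall>j<2*n. sform n (\<lambda>k. A k i) (\<lambda>k. A k j) mod int r = sympJ n i j mod int r) \<longleftrightarrow>
    sbasis n r n (\<lambda>j i. A i j) (\<lambda>j i. A i (n + j))" (is "?L \<longleftrightarrow> ?R")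
  proof
    assume ?L
    then show ?R
      unfolding all_less_double sbasis_def using r by (auto simp: sympJ_def)
  next
    assume R: ?R
    \<comment> \<open>\<open>sbasis\<close> leaves this block of the Gram matrix implicit;
      antisymmetry recovers it, and \<open>m1\<close> handles the residue of -1.\<close>
    have fe: "sform n (\<lambda>k. A k (n + i)) (\<lambda>k. A k j) mod int r = (if i = j then - 1 else 0) mod int r"
      if "i < n" "j < n" for i j
    proof -
      have "sform n (\<lambda>k. A k j) (\<lambda>k. A k (n + i)) mod int r = (if i = j then 1 else 0)"
        using R that by (auto simp: sbasis_def)
      then show ?thesis
        unfolding sform_swap[of n "\<lambda>k. A k (n + i)"]
        by (cases "i = j") (simp_all only: m1 if_True if_False simp_thms, simp add: mod_eq_0_iff_dvd)
    qed
    show ?L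
      unfolding all_less_double
    proof (intro allI impI conjI)
      fix i j assume ij: "i < n" "j < n"
      show "sform n (\<lambda>k. A k i) (\<lambda>k. A k j) mod int r = sympJ n i j mod int r"
        "sform n (\<lambda>k. A k i) (\<lambda>k. A k (n + j)) mod int r = sympJ n i (n + j) mod int r"
        "sform n (\<lambda>k. A k (n + i)) (\<lambda>k. A k (n + j)) mod int r = sympJ n (n + i) (n + j) mod int r"
        using R ij r by (auto simp: sympJ_def sbasis_def)
      show "sform n (\<lambda>k. A k (n + i)) (\<lambda>k. A k j) mod int r = sympJ n (n + i) j mod int r"
        using fe[OF ij] ij by (auto simp: sympJ_def)
    qed
  qed
  moreover have "(\<forall>i j. 2*n \<le> i \<or> 2*n \<le> j \<longrightarrow> A i j = 0) \<and> (\<forall>i j. 0 \<le> A i j \<and> A i j < int r) \<longleftrightarrow>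
    (\<forall>j<2*n. (\<lambda>i. A i j) \<in> vecs (2*n) r) \<and> (\<forall>i j. 2*n \<le> j \<longrightarrow> A i j = 0)" (is "?L \<longleftrightarrow> ?R")
  proof
    assume R: ?R
    have "(2*n \<le> i \<or> 2*n \<le> j \<longrightarrow> A i j = 0) \<and> 0 \<le> A i j \<and> A i j < int r" for i j
      using R r by (cases "j < 2 * n") (auto simp: vecs_def)
    then show ?L by blast
  qed (auto simp: vecs_def)
  ultimately show ?thesis
    unfolding sp_carrier_def sympJ_sum_eq_sform mem_Collect_eq by blast
qed

text \<open>Pairing with unit vectors reads off coordinates up to sign; these are reduced residues,
  so 0 modulo \<open>r\<close> means 0.\<close>

lemma nondeg_vecs:
  assumes "1 < r"
  shows "nondeg n r (vecs (2 * n) r)"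
  unfolding nondeg_def
proof (intro ballI impI)
  fix u assume u: "u \<in> vecs (2 * n) r" and *: "\<forall>w\<in>vecs (2 * n) r. sform n u w mod int r = 0"
  define unit :: "nat \<Rightarrow> nat \<Rightarrow> int" where "unit k = (\<lambda>i. if i = k then 1 else 0)" for k
  have unit: "unit k \<in> vecs (2 * n) r" if "k < 2 * n" for k
    using assms that by (auto simp: vecs_def unit_def)
  have ur: "u k mod int r = u k" for k using u by (simp add: vecs_def)
  have "u k = 0 \<and> u (n + k) = 0" if k: "k < n" for k
  proof
    have "sform n u (unit (n + k)) = (\<Sum>i<n. if i = k then u i else 0)"
      unfolding sform_def using k by (intro sum.cong) (auto simp: unit_def)
    then show "u k = 0" using *[rule_format, OF unit[of "n + k"]] k ur by simp
    have "sform n u (unit k) = (\<Sum>i<n. if i = k then - u (n + i) else 0)"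
      unfolding sform_def using k by (intro sum.cong) (auto simp: unit_def)
    then have "int r dvd u (n + k)" using *[rule_format, OF unit[of k]] k by (simp add: mod_eq_0_iff_dvd)
    then show "u (n + k) = 0" using ur[of "n + k"] by simp
  qed
  then have "\<forall>i<2*n. u i = 0" by (simp add: all_less_double)
  moreover have "\<forall>i\<ge>2*n. u i = 0" using u by (simp add: vecs_def)
  ultimately show "u = (\<lambda>_. 0)" by (meson ext not_less)
qed

lemma subspace_mod_vecs: "0 < r \<Longrightarrow> subspace_mod d r (vecs d r)"
  by (auto simp: subspace_mod_def vecs_def addmul_def)

theorem card_sp_carrier:
  assumes r: "Factorial_Ring.prime r"
  shows "card (sp_carrier n r) = (\<Prod>i=1..n. (r ^ (2 * i) - 1) * r ^ (2 * i - 1))"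
proof -
  have r1: "1 < r" using r prime_gt_1_nat by auto
  \<comment> \<open>\<open>T\<close> lists the pairs of columns; \<open>U\<close> reassembles them,
    with the 0 beyond column \<open>2 * n\<close> that \<open>sp_carrier\<close> requires.\<close>
  define T where "T A = map (\<lambda>j. (\<lambda>i. A i j, \<lambda>i. A i (n + j))) [0..<n]" for A :: "nat \<Rightarrow> nat \<Rightarrow> int"
  define U where "U ps = (\<lambda>i j. if j < n then fst (ps ! j) i else if j < 2 * n then snd (ps ! (j - n)) i else 0)"
    for ps :: "((nat \<Rightarrow> int) \<times> (nat \<Rightarrow> int)) list"
  have "bij_betw T (sp_carrier n r) (hpairs n r n (vecs (2 * n) r))"
  proof (rule bij_betwI[where g = U])
    show "T \<in> sp_carrier n r \<rightarrow> hpairs n r n (vecs (2 * n) r)"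
    proof
      fix A assume "A \<in> sp_carrier n r"
      then show "T A \<in> hpairs n r n (vecs (2 * n) r)"
        unfolding sp_carrier_iff[OF r1] hpairs_iff all_less_double by (auto simp: T_def sbasis_def)
    qed
    show "U \<in> hpairs n r n (vecs (2 * n) r) \<rightarrow> sp_carrier n r"
    proof
      fix ps assume "ps \<in> hpairs n r n (vecs (2 * n) r)"
      then show "U ps \<in> sp_carrier n r"
        unfolding sp_carrier_iff[OF r1] hpairs_iff all_less_double by (auto simp: U_def sbasis_def)
    qed
    show "U (T A) = A" if "A \<in> sp_carrier n r" for A
      using that unfolding sp_carrier_iff[OF r1] by (auto simp: U_def T_def fun_eq_iff)
    show "T (U ps) = ps" if "ps \<in> hpairs n r n (vecs (2 * n) r)" for ps
      using that unfolding hpairs_iff by (auto simp: U_def T_def intro!: nth_equalityI)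
  qed
  then have "card (sp_carrier n r) = card (hpairs n r n (vecs (2 * n) r))"
    by (rule bij_betw_same_card)
  also have "\<dots> = (\<Prod>i=1..n. (r ^ (2 * i) - 1) * r ^ (2 * i - 1))"
    using r1 by (intro card_hpairs[OF r subspace_mod_vecs nondeg_vecs card_vecs]) auto
  finally show ?thesis .
qed

subsection \<open>Prime factors of the group orders\<close>

text \<open>With \<open>b = a * c\<close>, \<open>x - 1\<close> divides \<open>x ^ c - 1\<close> at
  \<open>x = r ^ a\<close>, computed in the integers to avoid truncated subtraction; for
  \<open>r = 0\<close> truncation makes both sides 0.\<close>

lemma power_minus_one_dvd:
  fixes r :: nat
  assumes "a dvd b"
  shows "r ^ a - 1 dvd r ^ b - 1"
proof (cases "r = 0")
  case True
  then show ?thesis by (simp add: power_0_left)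
next
  case False
  obtain c where b: "b = a * c" using assms by (elim dvdE)
  have "int (r ^ a) - 1 dvd int (r ^ a) ^ c - 1"
    by (metis dvd_triv_left power_diff_1_eq)
  moreover have "int (r ^ a) - 1 = int (r ^ a - 1)" "int (r ^ a) ^ c - 1 = int (r ^ b - 1)"
    using False by (simp_all add: b power_mult of_nat_diff)
  ultimately show ?thesis by (metis int_dvd_int_iff)
qed

lemma bigOmega_card_sp_carrier:
  assumes r: "Factorial_Ring.prime r" and M: "bigOmega (r ^ nbar n - 1) \<le> M"
  shows "bigOmega (card (sp_carrier n r)) \<le> n\<^sup>2 + n * M"
proof -
  have r1: "1 < r" using r prime_gt_1_nat by blast
  have nz: "r ^ k - 1 \<noteq> 0" if "0 < k" for k
    using one_less_power[OF r1 that] by simp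
  \<comment> \<open>A positive \<open>nbar n\<close> makes \<open>r ^ nbar n - 1\<close> nonzero, as
    monotonicity of \<open>bigOmega\<close> requires.\<close>
  have "Lcm {1..n} \<noteq> 0" by (simp add: Lcm_0_iff)
  then have nb: "0 < nbar n" unfolding nbar_def by (simp only: nat_0_less_mult_iff neq0_conv) simp
  have factor: "bigOmega ((r ^ (2 * i) - 1) * r ^ (2 * i - 1)) \<le> M + (2 * i - 1)" if i: "i \<in> {1..n}" for i
  proof -
    have "2 * i dvd nbar n" unfolding nbar_def using i by (intro mult_dvd_mono dvd_Lcm) auto
    then have "bigOmega (r ^ (2 * i) - 1) \<le> bigOmega (r ^ nbar n - 1)"
      by (intro bigOmega_dvd_mono power_minus_one_dvd nz nb)
    then have "bigOmega (r ^ (2 * i) - 1) \<le> M" using M by simp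
    moreover have "bigOmega ((r ^ (2 * i) - 1) * r ^ (2 * i - 1)) = bigOmega (r ^ (2 * i) - 1) + (2 * i - 1)"
      using i r1 nz[of "2 * i"] by (subst bigOmega_mult) (auto simp: bigOmega_prime_power[OF r])
    ultimately show ?thesis by simp
  qed
  have "bigOmega (card (sp_carrier n r)) = (\<Sum>i=1..n. bigOmega ((r ^ (2 * i) - 1) * r ^ (2 * i - 1)))"
    unfolding card_sp_carrier[OF r]
    by (rule bigOmega_prod) (use r1 nz in auto)
  also have "\<dots> \<le> (\<Sum>i=1..n. M + (2 * i - 1))"
    by (rule sum_mono) (rule factor)
  \<comment> \<open>The first \<open>n\<close> odd numbers add up to
    \<open>n\<^sup>2\<close>.\<close>
  also have "\<dots> = n\<^sup>2 + n * M"
    by (induction n) (auto simp: power2_eq_square)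
  finally show ?thesis .
qed

theorem theorem3:
  fixes G :: "('a, 'b) monoid_scheme" (structure) and VV XX RR AA :: "'a set" and n r p :: nat
  assumes "0 < n"
    and r_pi: "r \<in> pi_set (nbar n) (Mbar (nbar n))"
    and grp: "group G"
    \<comment> \<open>R_{n,r}: extraspecial of order r^(2n+1) and exponent r\<close>
    and R_sub: "subgroup RR G" and R_X: "RR \<subseteq> XX"
    and R_es: "extraspecial (G\<lparr>carrier := RR\<rparr>) r"
    and R_card: "card RR = r ^ (2*n+1)"
    and R_exp: "\<forall>x\<in>RR. x [^]\<^bsub>G\<^esub> r = \<one>\<^bsub>G\<^esub>"
    \<comment> \<open>X_{n,r} = RR AA: RR normal in XX, AA a complement\<close>
    and X_sub: "subgroup XX G"
    and R_nor: "normal RR (G\<lparr>carrier := XX\<rparr>)"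
    and A_sub: "subgroup AA G" and A_X: "AA \<subseteq> XX"
    and RA_int: "RR \<inter> AA = {\<one>\<^bsub>G\<^esub>}"
    and RA_prod: "RR <#>\<^bsub>G\<^esub> AA = XX"
    \<comment> \<open>AA acts faithfully on RR (so AA <= Aut(RR)), centralizes Z(RR), and AA \<cong> Sp_{2n}(r)\<close>
    and A_faith: "\<forall>a\<in>AA. (\<forall>x\<in>RR. a \<otimes>\<^bsub>G\<^esub> x = x \<otimes>\<^bsub>G\<^esub> a) \<longrightarrow> a = \<one>\<^bsub>G\<^esub>"
    and A_cent: "\<forall>a\<in>AA. \<forall>z\<in>center (G\<lparr>carrier := RR\<rparr>). a \<otimes>\<^bsub>G\<^esub> z = z \<otimes>\<^bsub>G\<^esub> a"
    and A_Sp: "G\<lparr>carrier := AA\<rparr> \<cong> Sp n r"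
    \<comment> \<open>p prime, p = 1 mod r\<close>
    and p_prime: "Factorial_Ring.prime p" and p_cong: "p mod r = 1 mod r"
    \<comment> \<open>V_{n,r}: elementary abelian p-group of rank r^n (an F_p-space of dimension r^n)\<close>
    and V_nor: "normal VV G"
    and V_ab: "\<forall>u\<in>VV. \<forall>v\<in>VV. u \<otimes>\<^bsub>G\<^esub> v = v \<otimes>\<^bsub>G\<^esub> u"
    and V_exp: "\<forall>v\<in>VV. v [^]\<^bsub>G\<^esub> p = \<one>\<^bsub>G\<^esub>"
    and V_card: "card VV = p ^ (r ^ n)"
    \<comment> \<open>the conjugation action of XX on VV is faithful and irreducible\<close>
    and V_faith: "\<forall>x\<in>XX. (\<forall>v\<in>VV. x \<otimes>\<^bsub>G\<^esub> v = v \<otimes>\<^bsub>G\<^esub> x) \<longrightarrow> x = \<one>\<^bsub>G\<^esub>"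
    and V_irr: "\<forall>W. subgroup W G \<and> W \<subseteq> VV \<and>
                   (\<forall>x\<in>XX. \<forall>w\<in>W. x \<otimes>\<^bsub>G\<^esub> w \<otimes>\<^bsub>G\<^esub> inv\<^bsub>G\<^esub> x \<in> W)
                 \<longrightarrow> W = {\<one>\<^bsub>G\<^esub>} \<or> W = VV"
    \<comment> \<open>G = VV XX: semidirect product\<close>
    and VX_int: "VV \<inter> XX = {\<one>\<^bsub>G\<^esub>}"
    and VX_prod: "VV <#>\<^bsub>G\<^esub> XX = carrier G"
  shows "c_dimension G \<le> 2 * ((n+1)^2 + n * Mbar (nbar n))"
proof -
  interpret group G by (rule grp)
  have r: "Factorial_Ring.prime r" and M: "bigOmega (r ^ nbar n - 1) \<le> Mbar (nbar n)"
    using r_pi by (auto simp: pi_set_def)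
  have r1: "1 < r" using r prime_gt_1_nat by blast
  have cA: "card AA = card (sp_carrier n r)"
    using iso_same_card[OF A_Sp] by (simp add: Sp_def)
  have cX: "card XX = r ^ (2*n+1) * card (sp_carrier n r)"
    using card_set_mult_trivial_inter[OF R_sub A_sub RA_int] RA_prod R_card cA by simp
  have cG: "card (carrier G) = card VV * card XX"
    using card_set_mult_trivial_inter[OF normal_imp_subgroup[OF V_nor] X_sub VX_int] VX_prod by simp
  have sp0: "card (sp_carrier n r) \<noteq> 0"
  proof -
    have "(r ^ (2 * i) - 1) * r ^ (2 * i - 1) \<noteq> 0" if "i \<in> {1..n}" for i
      using that r1 one_less_power[OF r1, of "2 * i"] by simp
    then show ?thesis unfolding card_sp_carrier[OF r] by (subst prod_zero_iff) auto
  qed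
  then have "card (carrier G) \<noteq> 0"
    using cG cX V_card r1 prime_gt_0_nat[OF p_prime] by simp
  \<comment> \<open>An infinite set has \<open>card\<close> 0, so a nonzero order gives
    finiteness.\<close>
  then have fin: "finite (carrier G)" by (rule card_ge_0_finite[OF iffD1[OF neq0_conv]])
  have "bigOmega (card XX) = 2 * n + 1 + bigOmega (card (sp_carrier n r))"
    unfolding cX using r1 sp0 by (subst bigOmega_mult) (simp_all only: bigOmega_prime_power[OF r], auto)
  also have "\<dots> \<le> 2 * n + 1 + (n\<^sup>2 + n * Mbar (nbar n))"
    using bigOmega_card_sp_carrier[OF r M] by simp
  \<comment> \<open>The exponent \<open>2 * n + 1\<close> from the extraspecial group completes the
    square.\<close>
  also have "\<dots> = (n+1)^2 + n * Mbar (nbar n)"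
    by (simp add: power2_eq_square)
  finally show ?thesis
    using c_dimension_le_abelian_normal[OF V_nor V_ab fin cG] by simp
qed

end
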